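(* Let $f$ be a non-constant tropical meromorphic function of hyper-order $\varsigma<1$, let $\varepsilon>0$, let $q\ge1$, and let $a_1,\ldots,a_q\in\mathbb{R}$ be distinct values satisfying $$\max\{a_1,\ldots,a_q\}<\inf\{f(\alpha):\omega_f(\alpha)<0\}.$$ Then $$q\,T(r,f)=\sum_{k=1}^q N\bigl(r,1_\circ\oslash(f\oplus a_k)\bigr)+o\!\left(\frac{T(r,f)}{r^{1-\varsigma-\varepsilon}}\right)$$ for all $r$ outside of an exceptional set of finite logarithmic measure.
   Context: Tropical arithmetic: $1_\circ=0$, $a\oplus b=\max\{a,b\}$, $a\oslash b=a-b$; operations on functions are pointwise, so $f\oplus a_k=\max\{f,a_k\}$ and $1_\circ\oslash(f\oplus a_k)=-\max\{f,a_k\}$. A tropical meromorphic function is a continuous piecewise linear function $f:\mathbb{R}\to\mathbb{R}$ (real slopes; the points where the slope changes form a discrete set with no finite limit points). Put $\omega_f(x)=\lim_{\varepsilon\to0+}(f'(x+\varepsilon)-f'(x-\varepsilon))$. A point $x$ is a pole of $f$ if $\omega_f(x)<0$ and a root if $\omega_f(x)>0$, with multiplicity $|\omega_f(x)|$. The infimum of the empty set is $+\infty$. Nevanlinna functions: $m(r,f)=\frac12(f^+(r)+f^+(-r))$ with $f^+(x)=\max\{0,f(x)\}$; $n(t,f)=\sum_{|s|\le t,\ \omega_f(s)<0}|\omega_f(s)|$; $N(r,f)=\frac12\int_0^r n(t,f)\,dt$; $T(r,f)=m(r,f)+N(r,f)$. The hyper-order of $f$ is $\varsigma(f)=\limsup_{r\to\infty}\frac{\log\log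 T(r,f)}{\log r}$. The $o(\cdot)$ is understood as $r\to\infty$ outside the exceptional set; a set $E\subset[0,\infty)$ has finite logarithmic measure if $\int_{E\cap[1,\infty)}dr/r<\infty$. *)

theory Defs
  imports "HOL-Analysis.Analysis" "HOL-Library.Landau_Symbols"
begin

definition trop_one :: real  ("\<one>\<^sub>t") where
  "\<one>\<^sub>t = 0"

definition trop_add :: "real \<Rightarrow> real \<Rightarrow> real"  (infixl "\<oplus>\<^sub>t" 65) where
  "a \<oplus>\<^sub>t b = max a b"

definition trop_div :: "real \<Rightarrow> real \<Rightarrow> real"  (infixl "\<oslash>\<^sub>t" 70) where
  "a \<oslash>\<^sub>t b = a - b"

text \<open>The witness \<open>D\<close> contains the points where the slope changes. Having no limit point in
  the reals, it is closed and discrete, and \<open>f\<close> is affine on each component of its complement.\<close>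

definition tropical_meromorphic :: "(real \<Rightarrow> real) \<Rightarrow> bool" where
  "tropical_meromorphic f \<longleftrightarrow> continuous_on UNIV f \<and>
     (\<exists>D. (\<forall>x. \<not> x islimpt D) \<and>
          (\<forall>a b. a < b \<longrightarrow> {a<..<b} \<inter> D = {} \<longrightarrow>
             (\<exists>m c. \<forall>x\<in>{a<..<b}. f x = m * x + c)))"

definition slope_jump :: "(real \<Rightarrow> real) \<Rightarrow> real \<Rightarrow> real" where
  "slope_jump f x = Lim (at_right 0) (\<lambda>e. deriv f (x + e) - deriv f (x - e))"

definition trop_poles :: "(real \<Rightarrow> real) \<Rightarrow> real set" where
  "trop_poles f = {x. slope_jump f x < 0}"

definition proximity :: "real \<Rightarrow> (real \<Rightarrow> real) \<Rightarrow> real" where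
  "proximity r f = (max 0 (f r) + max 0 (f (- r))) / 2"

text \<open>For tropical meromorphic \<open>f\<close> only finitely many poles lie in \<open>[-t, t]\<close>, so the sum is
  a genuine finite sum.\<close>

definition pole_count :: "real \<Rightarrow> (real \<Rightarrow> real) \<Rightarrow> real" where
  "pole_count t f = (\<Sum>s\<in>{s \<in> trop_poles f. \<bar>s\<bar> \<le> t}. \<bar>slope_jump f s\<bar>)"

definition int_pole_count :: "real \<Rightarrow> (real \<Rightarrow> real) \<Rightarrow> real" where
  "int_pole_count r f = integral {0..r} (\<lambda>t. pole_count t f) / 2"

definition characteristic :: "real \<Rightarrow> (real \<Rightarrow> real) \<Rightarrow> real" where
  "characteristic r f = proximity r f + int_pole_count r f"

text \<open>If \<open>f\<close> is tropical meromorphic and non-constant, the characteristic grows at least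
  linearly, so the iterated logarithm is taken at arguments greater than 1 for all large \<open>r\<close>.\<close>

definition hyper_order :: "(real \<Rightarrow> real) \<Rightarrow> ereal" where
  "hyper_order f = Limsup at_top (\<lambda>r. ereal (ln (ln (characteristic r f)) / ln r))"

definition finite_log_measure :: "real set \<Rightarrow> bool" where
  "finite_log_measure E \<longleftrightarrow> E \<in> sets lebesgue \<and>
     (\<integral>\<^sup>+r\<in>E \<inter> {1..}. ennreal (1 / r) \<partial>lebesgue) < \<infinity>"

end

theory Submission
  imports Defs
begin

text \<open>
  The exceptional set can be taken empty, because the difference
  \<open>q T(r,f) - \<Sum>\<^sub>k N(r, -max f a\<^sub>k)\<close> is bounded, whereas \<open>T(r,f)\<close> grows at least linearly.

  Boundedness comes from the tropical Jensen formula
  \<open>N(r,-h) - N(r,h) = (h(r) + h(-r)) / 2 - h(0)\<close> (lemma \<open>tropical_Jensen\<close>), applied to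
  \<open>h = max f a\<close>. The condition on \<open>a\<close> says that all poles of \<open>f\<close> lie where \<open>f > a\<close>, and there
  truncation at level \<open>a\<close> changes nothing; where \<open>f \<le> a\<close> the truncation is locally a maximum of
  convex functions and creates no pole. So \<open>N(r, max f a) = N(r,f)\<close>. Since
  \<open>max f a\<close> and \<open>max f 0\<close> differ by at most \<open>\<bar>a\<bar>\<close>, the boundary term of Jensen's formula is
  \<open>m(r,f)\<close> up to a bounded error, which gives \<open>N(r, -max f a) = T(r,f) + O(1)\<close>.

  For the growth, a single pole makes \<open>N(r,f)\<close> grow linearly, and a single root makes
  \<open>N(r,-f)\<close>, which is at most \<open>T(r,f) - f(0)\<close> by Jensen's formula, grow linearly; without poles
  and roots \<open>f\<close> is affine and non-constant, and its proximity function grows linearly. Linear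
  growth also forces the hyper-order to be nonnegative, so that
  \<open>T(r,f) / r\<^sup>1\<^sup>-\<^sup>\<sigma>\<^sup>-\<^sup>\<epsilon>\<close> dominates \<open>r\<^sup>\<sigma>\<^sup>+\<^sup>\<epsilon>\<close> and tends to infinity.
\<close>

section \<open>One-sided slopes\<close>

definition has_slopes :: "(real \<Rightarrow> real) \<Rightarrow> real \<Rightarrow> real \<Rightarrow> real \<Rightarrow> bool" where
  "has_slopes h x m1 m2 \<longleftrightarrow>
     (\<exists>d>0. \<forall>y. \<bar>y - x\<bar> < d \<longrightarrow> h y = h x + (if y < x then m1 else m2) * (y - x))"

text \<open>Only the local shape of a tropical meromorphic function enters the arguments below. The
  local form has no distinguished exceptional set, which makes it stable under truncation and
  negation without any bookkeeping of such sets.\<close>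

definition piecewise_affine :: "(real \<Rightarrow> real) \<Rightarrow> bool" where
  "piecewise_affine h \<longleftrightarrow> (\<forall>x. \<exists>m1 m2. has_slopes h x m1 m2)"

lemma has_slopes_DERIV:
  assumes "has_slopes h x m m"
  shows "(h has_real_derivative m) (at x)"
proof -
  obtain d where d: "d > 0" "\<And>y. \<bar>y - x\<bar> < d \<Longrightarrow> h y = h x + m * (y - x)"
    using assms unfolding has_slopes_def by auto
  have "((\<lambda>y. h x + m * (y - x)) has_real_derivative m) (at x)"
    by (auto intro!: derivative_eq_intros)
  moreover have "\<forall>\<^sub>F y in nhds x. h y = h x + m * (y - x)"
    unfolding eventually_nhds_metric dist_real_def using d by blast
  ultimately show ?thesis
    by (subst DERIV_cong_ev[OF refl _ refl]) auto
qed

lemma has_slopes_near: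
  assumes "has_slopes h x m1 m2"
  obtains d where "d > 0"
    "\<And>y. \<lbrakk>x - d < y; y < x\<rbrakk> \<Longrightarrow> has_slopes h y m1 m1"
    "\<And>y. \<lbrakk>x < y; y < x + d\<rbrakk> \<Longrightarrow> has_slopes h y m2 m2"
proof -
  obtain d where d: "d > 0"
    "\<And>y. \<bar>y - x\<bar> < d \<Longrightarrow> h y = h x + (if y < x then m1 else m2) * (y - x)"
    using assms unfolding has_slopes_def by auto
  show thesis
  proof
    show "d > 0" by fact
  next
    fix y assume y: "x - d < y" "y < x"
    show "has_slopes h y m1 m1"
      unfolding has_slopes_def
    proof (intro exI[of _ "min (x - y) (y - (x - d))"] conjI allI impI)
      fix z assume "\<bar>z - y\<bar> < min (x - y) (y - (x - d))"
      then have "z < x" "\<bar>z - x\<bar> < d" by auto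
      then show "h z = h y + (if z < y then m1 else m1) * (z - y)"
        using d(2)[of z] d(2)[of y] y by (simp add: algebra_simps)
    qed (use y in auto)
  next
    fix y assume y: "x < y" "y < x + d"
    show "has_slopes h y m2 m2"
      unfolding has_slopes_def
    proof (intro exI[of _ "min (y - x) (x + d - y)"] conjI allI impI)
      fix z assume "\<bar>z - y\<bar> < min (y - x) (x + d - y)"
      then have "z > x" "\<bar>z - x\<bar> < d" by auto
      then show "h z = h y + (if z < y then m2 else m2) * (z - y)"
        using d(2)[of z] d(2)[of y] y by (simp add: algebra_simps)
    qed (use y in auto)
  qed
qed

lemma has_slopes_unique:
  assumes "has_slopes h x m1 m2" "has_slopes h x n1 n2"
  shows "m1 = n1" "m2 = n2"
proof -
  obtain d where d: "d > 0"
    "\<And>y. \<bar>y - x\<bar> < d \<Longrightarrow> h y = h x + (if y < x then m1 else m2) * (y - x)"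
    using assms(1) unfolding has_slopes_def by auto
  obtain e where e: "e > 0"
    "\<And>y. \<bar>y - x\<bar> < e \<Longrightarrow> h y = h x + (if y < x then n1 else n2) * (y - x)"
    using assms(2) unfolding has_slopes_def by auto
  define t where "t = min d e / 2"
  have t: "t > 0" "t < d" "t < e" using d(1) e(1) by (auto simp: t_def min_def)
  show "m1 = n1" "m2 = n2"
    using d(2)[of "x - t"] e(2)[of "x - t"] d(2)[of "x + t"] e(2)[of "x + t"] t by auto
qed

lemma slope_jump_eq:
  assumes "has_slopes h x m1 m2"
  shows "slope_jump h x = m2 - m1"
proof -
  obtain d where d: "d > 0"
    "\<And>y. \<lbrakk>x - d < y; y < x\<rbrakk> \<Longrightarrow> has_slopes h y m1 m1"
    "\<And>y. \<lbrakk>x < y; y < x + d\<rbrakk> \<Longrightarrow> has_slopes h y m2 m2"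
    using has_slopes_near[OF assms] by metis
  have "\<forall>\<^sub>F e in at_right 0. e < d \<and> e > 0"
    using d(1) by (auto simp: eventually_at_right)
  then have "\<forall>\<^sub>F e in at_right 0. deriv h (x + e) - deriv h (x - e) = m2 - m1"
  proof eventually_elim
    case (elim e)
    then have "deriv h (x + e) = m2" "deriv h (x - e) = m1"
      using d(2)[of "x - e"] d(3)[of "x + e"]
      by (auto intro!: DERIV_imp_deriv has_slopes_DERIV)
    then show ?case by simp
  qed
  then have "((\<lambda>e. deriv h (x + e) - deriv h (x - e)) \<longlongrightarrow> m2 - m1) (at_right 0)"
    by (rule tendsto_eventually)
  then show ?thesis
    unfolding slope_jump_def by (intro tendsto_Lim) auto
qed

lemma has_slopes_uminus:
  assumes "has_slopes h x m1 m2"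
  shows "has_slopes (\<lambda>y. - h y) x (- m1) (- m2)"
proof -
  obtain d where d: "d > 0"
    "\<And>y. \<bar>y - x\<bar> < d \<Longrightarrow> h y = h x + (if y < x then m1 else m2) * (y - x)"
    using assms unfolding has_slopes_def by auto
  have "- h y = - h x + (if y < x then - m1 else - m2) * (y - x)" if "\<bar>y - x\<bar> < d" for y
    using d(2)[OF that] by (cases "y < x") simp_all
  then show ?thesis unfolding has_slopes_def using d(1) by blast
qed

lemma piecewise_affine_uminus:
  "piecewise_affine h \<Longrightarrow> piecewise_affine (\<lambda>y. - h y)"
  unfolding piecewise_affine_def by (metis has_slopes_uminus)

lemma slope_jump_uminus:
  assumes "piecewise_affine h"
  shows "slope_jump (\<lambda>y. - h y) x = - slope_jump h x"
proof -
  obtain m1 m2 where m: "has_slopes h x m1 m2"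
    using assms unfolding piecewise_affine_def by blast
  show ?thesis
    using slope_jump_eq[OF m] slope_jump_eq[OF has_slopes_uminus[OF m]] by simp
qed

lemma piecewise_affine_isCont:
  assumes "piecewise_affine h"
  shows "isCont h x"
proof -
  obtain m1 m2 where "has_slopes h x m1 m2"
    using assms unfolding piecewise_affine_def by blast
  then obtain d where d: "d > 0"
    "\<And>y. \<bar>y - x\<bar> < d \<Longrightarrow> h y = h x + (if y < x then m1 else m2) * (y - x)"
    unfolding has_slopes_def by auto
  have "\<forall>\<^sub>F y in at x. norm (h y - h x) \<le> norm (y - x) * (\<bar>m1\<bar> + \<bar>m2\<bar>)"
    unfolding eventually_at
  proof (intro exI[of _ d] conjI ballI impI)
    fix y assume "y \<noteq> x \<and> dist y x < d"
    then have "h y - h x = (if y < x then m1 else m2) * (y - x)"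
      using d(2)[of y] by (simp add: dist_real_def)
    moreover have "\<bar>if y < x then m1 else m2\<bar> \<le> \<bar>m1\<bar> + \<bar>m2\<bar>" by auto
    ultimately show "norm (h y - h x) \<le> norm (y - x) * (\<bar>m1\<bar> + \<bar>m2\<bar>)"
      by (simp add: abs_mult mult.commute mult_left_mono)
  qed (use d(1) in auto)
  moreover have "((\<lambda>y. y - x) \<longlongrightarrow> 0) (at x)"
    by (auto intro!: tendsto_eq_intros)
  ultimately have "((\<lambda>y. h y - h x) \<longlongrightarrow> 0) (at x)"
    by (rule tendsto_0_le[rotated])
  then show ?thesis
    unfolding isCont_def by (simp add: LIM_zero_iff)
qed

lemma affine_on_extend:
  fixes h :: "real \<Rightarrow> real"
  assumes "a < b" "continuous_on {a..b} h" "\<And>y. y \<in> {a<..<b} \<Longrightarrow> h y = m * y + c"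
    and "x \<in> {a..b}"
  shows "h x = m * x + c"
proof -
  have "h x - (m * x + c) = 0"
  proof (rule continuous_constant_on_closure[of "{a<..<b}" "\<lambda>x. h x - (m * x + c)"])
    show "continuous_on (closure {a<..<b}) (\<lambda>x. h x - (m * x + c))"
      using assms by (auto intro!: continuous_intros)
  qed (use assms in auto)
  then show ?thesis by simp
qed

lemma tropical_meromorphic_imp_piecewise_affine:
  assumes "tropical_meromorphic f"
  shows "piecewise_affine f"
  unfolding piecewise_affine_def
proof
  fix x
  obtain D where cont: "continuous_on UNIV f" and D: "\<And>x. \<not> x islimpt D"
    and aff: "\<And>a b. a < b \<Longrightarrow> {a<..<b} \<inter> D = {} \<Longrightarrow> \<exists>m c. \<forall>x\<in>{a<..<b}. f x = m * x + c"
    using assms unfolding tropical_meromorphic_def by blast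
  have "\<forall>\<^sub>F y in at x. y \<notin> D"
    using D[of x] by (simp add: islimpt_iff_eventually)
  then obtain d where d: "d > 0" "\<And>y. \<lbrakk>y \<noteq> x; \<bar>y - x\<bar> < d\<rbrakk> \<Longrightarrow> y \<notin> D"
    unfolding eventually_at dist_real_def by auto
  have "{x-d<..<x} \<inter> D = {}" "{x<..<x+d} \<inter> D = {}"
    using d(2) by force+
  then obtain m1 c1 m2 c2 where m:
    "\<And>y. y \<in> {x-d<..<x} \<Longrightarrow> f y = m1 * y + c1"
    "\<And>y. y \<in> {x<..<x+d} \<Longrightarrow> f y = m2 * y + c2"
    using aff[of "x - d" x] aff[of x "x + d"] d(1) by auto
  have ext: "f y = m1 * y + c1" if "y \<in> {x-d..x}" for y
    using affine_on_extend[where a = "x - d" and b = x, OF _ _ m(1), of y]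
      d(1) that continuous_on_subset[OF cont] by auto
  have ext': "f y = m2 * y + c2" if "y \<in> {x..x+d}" for y
    using affine_on_extend[where a = x and b = "x + d", OF _ _ m(2), of y]
      d(1) that continuous_on_subset[OF cont] by auto
  have "has_slopes f x m1 m2"
    unfolding has_slopes_def
  proof (intro exI[of _ d] conjI allI impI)
    fix y assume "\<bar>y - x\<bar> < d"
    then show "f y = f x + (if y < x then m1 else m2) * (y - x)"
      using ext[of y] ext[of x] ext'[of y] ext'[of x] d(1) by (auto simp: algebra_simps)
  qed (use d(1) in auto)
  then show "\<exists>m1 m2. has_slopes f x m1 m2" by blast
qed

section \<open>Counting poles and roots\<close>

lemma finite_kinks:
  assumes "piecewise_affine h"
  shows "finite {s \<in> {a..b}. slope_jump h s \<noteq> 0}"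
proof -
  have "\<not> x islimpt {s. slope_jump h s \<noteq> 0}" for x
  proof -
    obtain m1 m2 where "has_slopes h x m1 m2"
      using assms unfolding piecewise_affine_def by blast
    then obtain d where d: "d > 0"
      "\<And>y. \<lbrakk>x - d < y; y < x\<rbrakk> \<Longrightarrow> has_slopes h y m1 m1"
      "\<And>y. \<lbrakk>x < y; y < x + d\<rbrakk> \<Longrightarrow> has_slopes h y m2 m2"
      using has_slopes_near by metis
    have "slope_jump h y = 0" if "y \<noteq> x" "\<bar>y - x\<bar> < d" for y
      using that d(2,3)[of y] slope_jump_eq[of h y] by (cases "y < x") force+
    then show ?thesis
      unfolding islimpt_iff_eventually eventually_at dist_real_def using d(1) by auto
  qed
  then have "finite ({a..b} \<inter> {s. slope_jump h s \<noteq> 0})"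
    by (intro finite_not_islimpt_in_compact) auto
  then show ?thesis by (simp add: Int_def)
qed

text \<open>Both sides are additive over adjacent intervals, and on a short interval around any point
  the right slope changes at most once; bisection does the rest. Half-open intervals are what
  makes right slopes and jumps match.\<close>

lemma right_slope_diff_eq_sum_jumps:
  assumes slopes: "\<And>x. has_slopes h x (L x) (R x)" and "a \<le> b"
  shows "R b - R a = (\<Sum>s | s \<in> {a<..b} \<and> slope_jump h s \<noteq> 0. slope_jump h s)"
  using \<open>a \<le> b\<close>
proof (induction rule: Bolzano)
  case (trans a b c)
  have pa: "piecewise_affine h" unfolding piecewise_affine_def using slopes by blast
  have fin: "finite {s \<in> {u<..v}. slope_jump h s \<noteq> 0}" for u v
    by (rule finite_subset[OF _ finite_kinks[OF pa, of u v]]) auto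
  have "{s \<in> {a<..c}. slope_jump h s \<noteq> 0} =
      {s \<in> {a<..b}. slope_jump h s \<noteq> 0} \<union> {s \<in> {b<..c}. slope_jump h s \<noteq> 0}"
    using trans by auto
  then have "(\<Sum>s | s \<in> {a<..c} \<and> slope_jump h s \<noteq> 0. slope_jump h s) =
      (\<Sum>s | s \<in> {a<..b} \<and> slope_jump h s \<noteq> 0. slope_jump h s) +
      (\<Sum>s | s \<in> {b<..c} \<and> slope_jump h s \<noteq> 0. slope_jump h s)"
    using fin by (simp only:) (intro sum.union_disjoint; auto)
  then show ?case using trans by simp
next
  case (local x)
  obtain d where d: "d > 0"
    "\<And>y. \<lbrakk>x - d < y; y < x\<rbrakk> \<Longrightarrow> has_slopes h y (L x) (L x)"
    "\<And>y. \<lbrakk>x < y; y < x + d\<rbrakk> \<Longrightarrow> has_slopes h y (R x) (R x)"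
    using has_slopes_near[OF slopes[of x]] by metis
  have left: "R y = L x" "slope_jump h y = 0" if "x - d < y" "y < x" for y
    using has_slopes_unique[OF slopes d(2)[OF that]] slope_jump_eq[OF d(2)[OF that]] by auto
  have right: "R y = R x" "slope_jump h y = 0" if "x < y" "y < x + d" for y
    using has_slopes_unique[OF slopes d(3)[OF that]] slope_jump_eq[OF d(3)[OF that]] by auto
  show ?case
  proof (intro exI[of _ d] conjI allI impI)
    fix a b assume ab: "a \<le> x \<and> x \<le> b \<and> b - a < d"
    have other: "slope_jump h s = 0" if "s \<in> {a<..b}" "s \<noteq> x" for s
    proof (cases "s < x")
      case True
      show ?thesis by (rule left(2)) (use that ab True in auto)
    next
      case False
      show ?thesis by (rule right(2)) (use that ab False in auto)
    qed
    have Rb: "R b = R x" using right(1)[of b] ab by (cases "b = x") auto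
    show "R b - R a = (\<Sum>s | s \<in> {a<..b} \<and> slope_jump h s \<noteq> 0. slope_jump h s)"
    proof (cases "a = x \<or> slope_jump h x = 0")
      case True
      then have "{s \<in> {a<..b}. slope_jump h s \<noteq> 0} = {}"
        using other by (cases "a = x") fastforce+
      moreover have "R a = R x"
        using True left(1)[of a] slope_jump_eq[OF slopes[of x]] ab by (cases "a = x") auto
      ultimately show ?thesis using Rb by simp
    next
      case False
      then have "{s \<in> {a<..b}. slope_jump h s \<noteq> 0} = {x}"
        using other ab by auto
      moreover have "R a = L x" using False ab left(1)[of a] by auto
      ultimately show ?thesis using Rb slope_jump_eq[OF slopes[of x]] by simp
    qed
  qed (use d(1) in auto)
qed

lemma pole_count_eq:
  assumes "piecewise_affine h"
  shows "pole_count t h =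
    (\<Sum>s | s \<in> {-t..t} \<and> slope_jump h s \<noteq> 0. max 0 (- slope_jump h s))"
  unfolding pole_count_def
proof (rule sum.mono_neutral_cong_left)
  show "finite {s \<in> {-t..t}. slope_jump h s \<noteq> 0}" by (rule finite_kinks[OF assms])
qed (auto simp: trop_poles_def abs_le_iff)

lemma pole_count_nonneg: "pole_count t h \<ge> 0"
  unfolding pole_count_def by (intro sum_nonneg) auto

lemma finite_trop_poles:
  assumes "piecewise_affine h"
  shows "finite {s \<in> trop_poles h. \<bar>s\<bar> \<le> t}"
  by (rule finite_subset[OF _ finite_kinks[OF assms, of "-t" t]])
    (auto simp: trop_poles_def abs_le_iff)

lemma pole_count_integrable:
  assumes "piecewise_affine h"
  shows "(\<lambda>t. pole_count t h) integrable_on {a..b}"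
proof (intro integrable_on_mono_on monotone_onI)
  fix t u :: real assume "t \<le> u"
  then show "pole_count t h \<le> pole_count u h"
    unfolding pole_count_def by (intro sum_mono2 finite_trop_poles[OF assms]) auto
qed

lemma int_pole_count_nonneg: "int_pole_count r h \<ge> 0"
  unfolding int_pole_count_def
  using integral_nonneg[of "\<lambda>t. pole_count t h" "{0..r}"]
  by (cases "(\<lambda>t. pole_count t h) integrable_on {0..r}") (auto simp: pole_count_nonneg not_integrable_integral)

lemma int_pole_count_ge_linear:
  assumes h: "piecewise_affine h" and s: "s \<in> trop_poles h" and r: "r \<ge> \<bar>s\<bar>"
  shows "int_pole_count r h \<ge> \<bar>slope_jump h s\<bar> * (r - \<bar>s\<bar>) / 2"
proof -
  have "\<bar>slope_jump h s\<bar> \<le> pole_count t h" if "\<bar>s\<bar> \<le> t" for t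
    unfolding pole_count_def using s that finite_trop_poles[OF h, of t]
    by (intro member_le_sum) auto
  then have "\<bar>slope_jump h s\<bar> * (r - \<bar>s\<bar>) \<le> integral {\<bar>s\<bar>..r} (\<lambda>t. pole_count t h)"
    using r integral_le[of "\<lambda>t. \<bar>slope_jump h s\<bar>" "{\<bar>s\<bar>..r}" "\<lambda>t. pole_count t h"]
      pole_count_integrable[OF h] by (auto simp: mult.commute)
  also have "\<dots> \<le> integral {0..r} (\<lambda>t. pole_count t h)"
    by (intro integral_subset_le pole_count_integrable[OF h]) (auto simp: pole_count_nonneg)
  finally show ?thesis unfolding int_pole_count_def by simp
qed

section \<open>The tropical Jensen formula\<close>

text \<open>The function \<open>t \<mapsto> h(t) + h(-t)\<close> has derivative \<open>h'(t) - h'(-t)\<close>, the total slope jump on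
  \<open>[-t, t]\<close>, that is, the number of roots minus the number of poles there, except at the finitely
  many \<open>t\<close> for which \<open>t\<close> or \<open>-t\<close> is a kink. Integrating over \<open>[0, r]\<close> gives the formula.\<close>

lemma tropical_Jensen:
  assumes h: "piecewise_affine h" and "r \<ge> 0"
  shows "int_pole_count r (\<lambda>x. - h x) - int_pole_count r h = (h r + h (- r)) / 2 - h 0"
proof -
  note h' = piecewise_affine_uminus[OF h]
  obtain L R where slopes: "\<And>x. has_slopes h x (L x) (R x)"
    using h unfolding piecewise_affine_def by metis
  define K where "K t = {s \<in> {-t..t}. slope_jump h s \<noteq> 0}" for t
  define c where "c t = (\<Sum>s\<in>K t. slope_jump h s)" for t
  have c: "c t = pole_count t (\<lambda>x. - h x) - pole_count t h" for t
    unfolding c_def K_def pole_count_eq[OF h] pole_count_eq[OF h'] slope_jump_uminus[OF h]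
    by (simp add: sum_subtractf[symmetric]) (intro sum.cong; auto)
  have "(c has_integral (h r + h (- r)) - (h 0 + h (- 0))) {0..r}"
  proof (rule fundamental_theorem_of_calculus_interior_strong[of "K r \<union> uminus ` K r"])
    show "finite (K r \<union> uminus ` K r)"
      unfolding K_def using finite_kinks[OF h, of "-r" r] by blast
  next
    \<comment> \<open>Since \<open>-t\<close> is not a kink, the half-open interval of the telescoping sum may be closed.\<close>
    fix t assume t: "t \<in> {0<..<r} - (K r \<union> uminus ` K r)"
    then have "t \<notin> K r" "- t \<notin> K r" by (auto simp: image_iff)
    then have j: "slope_jump h t = 0" "slope_jump h (- t) = 0"
      using t unfolding K_def by auto
    then have "L t = R t" "L (- t) = R (- t)"
      using slope_jump_eq[OF slopes] by auto
    then have der: "(h has_real_derivative R t) (at t)"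
      "(h has_real_derivative R (- t)) (at (- t))"
      using has_slopes_DERIV slopes by metis+
    have "{s \<in> {-t<..t}. slope_jump h s \<noteq> 0} = K t"
      unfolding K_def using j by (auto simp: le_less)
    then have "R t - R (- t) = c t"
      using right_slope_diff_eq_sum_jumps[OF slopes, of "- t" t] t unfolding c_def by simp
    moreover have "((\<lambda>t. h t + h (- t)) has_real_derivative R t + R (- t) * (- 1)) (at t)"
      using der by (auto intro!: derivative_eq_intros DERIV_chain2[of h])
    ultimately show "((\<lambda>t. h t + h (- t)) has_vector_derivative c t) (at t)"
      by (simp add: has_real_derivative_iff_has_vector_derivative)
  next
    have "continuous_on UNIV h"
      using piecewise_affine_isCont[OF h] by (simp add: continuous_on_eq_continuous_at)
    then show "continuous_on {0..r} (\<lambda>t. h t + h (- t))"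
      by (auto intro!: continuous_intros continuous_on_compose2[of UNIV h])
  qed fact
  moreover have "(c has_integral (integral {0..r} (\<lambda>t. pole_count t (\<lambda>x. - h x))
      - integral {0..r} (\<lambda>t. pole_count t h))) {0..r}"
    unfolding c using pole_count_integrable[OF h] pole_count_integrable[OF h']
    by (intro has_integral_diff integrable_integral)
  ultimately have "integral {0..r} (\<lambda>t. pole_count t (\<lambda>x. - h x))
      - integral {0..r} (\<lambda>t. pole_count t h) = (h r + h (- r)) - (h 0 + h (- 0))"
    by (rule has_integral_unique[symmetric])
  then show ?thesis
    unfolding int_pole_count_def by (simp add: field_simps)
qed

section \<open>Truncation\<close>

text \<open>At a point where \<open>f = a\<close>, truncation flattens a descending right branch and an ascending
  left branch, so the slopes become \<open>min m1 0\<close> and \<open>max m2 0\<close>.\<close>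

lemma has_slopes_max:
  assumes "piecewise_affine f" "has_slopes f x m1 m2"
  shows "f x > a \<Longrightarrow> has_slopes (\<lambda>y. max (f y) a) x m1 m2"
    and "f x < a \<Longrightarrow> has_slopes (\<lambda>y. max (f y) a) x 0 0"
    and "f x = a \<Longrightarrow> has_slopes (\<lambda>y. max (f y) a) x (min m1 0) (max m2 0)"
proof -
  obtain d where d: "d > 0"
    "\<And>y. \<bar>y - x\<bar> < d \<Longrightarrow> f y = f x + (if y < x then m1 else m2) * (y - x)"
    using assms(2) unfolding has_slopes_def by auto
  have cont: "f \<midarrow>x\<rightarrow> f x"
    using piecewise_affine_isCont[OF assms(1)] by (simp add: isCont_def)
  {
    assume fx: "f x > a"
    have "\<forall>\<^sub>F y in at x. f y > a" using order_tendstoD(1)[OF cont fx] .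
    then obtain e where e: "e > 0" "\<And>y. \<lbrakk>y \<noteq> x; \<bar>y - x\<bar> < e\<rbrakk> \<Longrightarrow> f y > a"
      unfolding eventually_at dist_real_def by auto
    have e': "f y > a" if "\<bar>y - x\<bar> < e" for y
      using e(2)[of y] fx that by (cases "y = x") auto
    show "has_slopes (\<lambda>y. max (f y) a) x m1 m2"
      unfolding has_slopes_def
    proof (intro exI[of _ "min d e"] conjI allI impI)
      fix y assume "\<bar>y - x\<bar> < min d e"
      then show "max (f y) a = max (f x) a + (if y < x then m1 else m2) * (y - x)"
        using e'[of y] d(2)[of y] fx by (simp add: max_absorb1)
    qed (use d(1) e(1) in auto)
  next
    assume fx: "f x < a"
    have "\<forall>\<^sub>F y in at x. f y < a" using order_tendstoD(2)[OF cont fx] .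
    then obtain e where e: "e > 0" "\<And>y. \<lbrakk>y \<noteq> x; \<bar>y - x\<bar> < e\<rbrakk> \<Longrightarrow> f y < a"
      unfolding eventually_at dist_real_def by auto
    have e': "f y < a" if "\<bar>y - x\<bar> < e" for y
      using e(2)[of y] fx that by (cases "y = x") auto
    show "has_slopes (\<lambda>y. max (f y) a) x 0 0"
      unfolding has_slopes_def
    proof (intro exI[of _ e] conjI allI impI)
      fix y assume "\<bar>y - x\<bar> < e"
      then show "max (f y) a = max (f x) a + (if y < x then 0 else 0) * (y - x)"
        using e'[of y] fx by simp
    qed (use e(1) in auto)
  next
    assume fx: "f x = a"
    show "has_slopes (\<lambda>y. max (f y) a) x (min m1 0) (max m2 0)"
      unfolding has_slopes_def
    proof (intro exI[of _ d] conjI allI impI)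
      fix y assume y: "\<bar>y - x\<bar> < d"
      have "max (a + m1 * (y - x)) a = a + min m1 0 * (y - x)" if "y < x"
        using that by (auto simp: max_def min_def mult_le_0_iff zero_le_mult_iff)
      moreover have "max (a + m2 * (y - x)) a = a + max m2 0 * (y - x)" if "y \<ge> x"
        using that by (auto simp: max_def mult_le_0_iff zero_le_mult_iff)
      ultimately show
        "max (f y) a = max (f x) a + (if y < x then min m1 0 else max m2 0) * (y - x)"
        using d(2)[OF y] fx by auto
    qed (use d(1) in auto)
  }
qed

lemma piecewise_affine_max:
  assumes "piecewise_affine f"
  shows "piecewise_affine (\<lambda>y. max (f y) a)"
  unfolding piecewise_affine_def
proof
  fix x
  obtain m1 m2 where "has_slopes f x m1 m2"
    using assms unfolding piecewise_affine_def by blast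
  then show "\<exists>m1 m2. has_slopes (\<lambda>y. max (f y) a) x m1 m2"
    using has_slopes_max[OF assms, of x m1 m2 a] by (cases "f x" a rule: linorder_cases) blast+
qed

text \<open>Where \<open>f \<noteq> a\<close>, the truncation is locally \<open>f\<close> or a constant, and in the second case \<open>f\<close> has
  no pole to lose. Where \<open>f = a\<close>, truncation replaces the slopes by \<open>min m1 0\<close> and \<open>max m2 0\<close>,
  whose jump is nonnegative, and again \<open>f\<close> itself has no pole there.\<close>

lemma pole_count_max:
  assumes f: "piecewise_affine f" and poles: "\<And>s. s \<in> trop_poles f \<Longrightarrow> a < f s"
  shows "pole_count t (\<lambda>y. max (f y) a) = pole_count t f"
proof -
  let ?h = "\<lambda>y. max (f y) a"
  have "(slope_jump ?h s < 0 \<longleftrightarrow> slope_jump f s < 0) \<and>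
      (slope_jump f s < 0 \<longrightarrow> slope_jump ?h s = slope_jump f s)" for s
  proof -
    obtain m1 m2 where m: "has_slopes f s m1 m2"
      using f unfolding piecewise_affine_def by blast
    note jf = slope_jump_eq[OF m]
    have np: "\<not> slope_jump f s < 0" if "f s \<le> a"
      using poles[of s] that by (auto simp: trop_poles_def)
    consider "f s > a" | "f s < a" | "f s = a" by linarith
    then show ?thesis
    proof cases
      case 1
      then show ?thesis using slope_jump_eq[OF has_slopes_max(1)[OF f m]] jf by simp
    next
      case 2
      then show ?thesis using slope_jump_eq[OF has_slopes_max(2)[OF f m]] np by simp
    next
      case 3
      have "slope_jump ?h s \<ge> 0"
        using slope_jump_eq[OF has_slopes_max(3)[OF f m 3]] by simp
      then show ?thesis using np 3 by auto
    qed
  qed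
  then show ?thesis
    unfolding pole_count_def trop_poles_def by (intro sum.cong) auto
qed

text \<open>This is the statement \<open>N(r, -max f a) = T(r,f) + O(1)\<close> with an explicit constant: \<open>\<bar>a\<bar>\<close> is the
  price of replacing \<open>max f a\<close> by \<open>max f 0\<close> at \<open>r\<close> and \<open>-r\<close>, and \<open>max (f 0) a\<close> is the constant term
  of Jensen's formula.\<close>

lemma int_pole_count_truncation_bound:
  assumes f: "piecewise_affine f" and poles: "\<And>s. s \<in> trop_poles f \<Longrightarrow> a < f s" and "r \<ge> 0"
  shows "\<bar>characteristic r f - int_pole_count r (\<lambda>y. - max (f y) a)\<bar> \<le> \<bar>a\<bar> + \<bar>max (f 0) a\<bar>"
proof -
  have "int_pole_count r (\<lambda>y. - max (f y) a) - int_pole_count r f =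
      (max (f r) a + max (f (- r)) a) / 2 - max (f 0) a"
    using tropical_Jensen[OF piecewise_affine_max[OF f] \<open>r \<ge> 0\<close>, of a] pole_count_max[OF f poles]
    unfolding int_pole_count_def by simp
  moreover have "\<bar>(max 0 u + max 0 v) / 2 - (max u a + max v a) / 2\<bar> \<le> \<bar>a\<bar>" for u v :: real
  proof -
    have "\<bar>max 0 w - max w a\<bar> \<le> \<bar>a\<bar>" for w by linarith
    from this[of u] this[of v] show ?thesis by (simp only: abs_le_iff) argo
  qed
  from this[of "f r" "f (- r)"]
  have "\<bar>(max 0 (f r) + max 0 (f (- r))) / 2 - (max (f r) a + max (f (- r)) a) / 2\<bar> \<le> \<bar>a\<bar>" .
  ultimately show ?thesis
    unfolding characteristic_def proximity_def abs_le_iff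
    using abs_ge_self[of "max (f 0) a"] abs_ge_minus_self[of "max (f 0) a"] by argo
qed

section \<open>Growth of the characteristic\<close>

lemma affine_if_no_jumps:
  assumes h: "piecewise_affine h" and j: "\<And>s. slope_jump h s = 0"
  obtains m where "\<And>x. h x = h 0 + m * x"
proof -
  obtain L R where slopes: "\<And>x. has_slopes h x (L x) (R x)"
    using h unfolding piecewise_affine_def by metis
  have LR: "L x = R x" for x
    using slope_jump_eq[OF slopes[of x]] j by simp
  have "R b = R a" if "a \<le> b" for a b
    using right_slope_diff_eq_sum_jumps[OF slopes that] by (simp add: j)
  then have "R x = R 0" for x by (metis linear)
  then have "(h has_real_derivative R 0) (at x)" for x
    using has_slopes_DERIV[of h x "R x"] slopes[of x] LR[of x] by metis
  then have "((\<lambda>x. h x - R 0 * x) has_real_derivative 0) (at x)" for x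
    by (auto intro!: derivative_eq_intros)
  then have const: "h x - R 0 * x = h 0 - R 0 * 0" for x
    by (intro DERIV_isconst_all) blast
  have "h x = h 0 + R 0 * x" for x
    using const[of x] by simp
  then show thesis by (rule that)
qed

lemma characteristic_ge_linear:
  assumes f: "piecewise_affine f" and nc: "\<not> f constant_on UNIV"
  obtains c where "c > 0" "\<forall>\<^sub>F r in at_top. characteristic r f \<ge> c * r"
proof -
  have "\<exists>w C. w > 0 \<and> (\<forall>\<^sub>F r in at_top. characteristic r f \<ge> w * r - C)"
  proof (cases "\<exists>s. slope_jump f s \<noteq> 0")
    case True
    then obtain s where s: "slope_jump f s \<noteq> 0" by blast
    define w where "w = \<bar>slope_jump f s\<bar> / 2"
    have "w > 0" using s by (simp add: w_def)
    have "characteristic r f \<ge> w * r - (w * \<bar>s\<bar> + \<bar>f 0\<bar>)" if r: "r \<ge> \<bar>s\<bar>" for r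
    proof (cases "slope_jump f s < 0")
      case True
      then have "int_pole_count r f \<ge> w * (r - \<bar>s\<bar>)"
        using int_pole_count_ge_linear[OF f _ r] by (simp add: trop_poles_def w_def)
      moreover have "proximity r f \<ge> 0" unfolding proximity_def by simp
      ultimately show ?thesis
        unfolding characteristic_def right_diff_distrib using abs_ge_zero[of "f 0"] by linarith
    next
      case False
      then have "slope_jump (\<lambda>x. - f x) s < 0"
        using s by (simp add: slope_jump_uminus[OF f])
      then have "int_pole_count r (\<lambda>x. - f x) \<ge> w * (r - \<bar>s\<bar>)"
        using int_pole_count_ge_linear[OF piecewise_affine_uminus[OF f] _ r]
        by (simp add: trop_poles_def w_def slope_jump_uminus[OF f])
      moreover have "int_pole_count r (\<lambda>x. - f x) - int_pole_count r f
          = (f r + f (- r)) / 2 - f 0"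
        using tropical_Jensen[OF f] r by simp
      moreover have "proximity r f \<ge> (f r + f (- r)) / 2"
        unfolding proximity_def by (intro divide_right_mono add_mono) auto
      ultimately show ?thesis
        unfolding characteristic_def right_diff_distrib
        using abs_ge_minus_self[of "f 0"] by linarith
    qed
    then show ?thesis
      using \<open>w > 0\<close>
      by (intro exI[of _ w] exI[of _ "w * \<bar>s\<bar> + \<bar>f 0\<bar>"] conjI
          eventually_at_top_linorderI[of "\<bar>s\<bar>"])
  next
    case False
    then obtain m where m: "\<And>x. f x = f 0 + m * x"
      using affine_if_no_jumps[OF f] by metis
    have "m \<noteq> 0"
    proof
      assume "m = 0"
      then have "f x = f 0" for x using m[of x] by simp
      then show False using nc unfolding constant_on_def by blast
    qed
    have "characteristic r f \<ge> \<bar>m\<bar> / 2 * r - \<bar>f 0\<bar>" if "r \<ge> 0" for r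
    proof -
      have "\<bar>m\<bar> / 2 * r = \<bar>m * r\<bar> / 2" using that by (simp add: abs_mult)
      moreover have "\<bar>v\<bar> / 2 - \<bar>u\<bar> \<le> (max 0 (u + v) + max 0 (u - v)) / 2" for u v :: real
        by (auto simp: max_def abs_if)
      moreover have "f r = f 0 + m * r" "f (- r) = f 0 - m * r"
        using m[of r] m[of "- r"] by simp_all
      ultimately have "proximity r f \<ge> \<bar>m\<bar> / 2 * r - \<bar>f 0\<bar>"
        unfolding proximity_def by metis
      then show ?thesis
        unfolding characteristic_def using int_pole_count_nonneg[of r f] by linarith
    qed
    then show ?thesis
      using \<open>m \<noteq> 0\<close>
      by (intro exI[of _ "\<bar>m\<bar> / 2"] exI[of _ "\<bar>f 0\<bar>"] conjI
          eventually_at_top_linorderI[of 0]) simp_all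
  qed
  then obtain w C where w: "w > 0" "\<forall>\<^sub>F r in at_top. characteristic r f \<ge> w * r - C"
    by blast
  \<comment> \<open>Half of the slope absorbs the additive constant.\<close>
  have "\<forall>\<^sub>F r in at_top. characteristic r f \<ge> w / 2 * r"
    using w(2) eventually_ge_at_top[of "2 * C / w"]
  proof eventually_elim
    case (elim r)
    then have "2 * C \<le> w * r" using w(1) by (simp add: field_simps)
    then show ?case using elim by simp
  qed
  then show thesis using that[of "w / 2"] w(1) by simp
qed

lemma hyper_order_nonneg:
  assumes c: "c > 0" "\<forall>\<^sub>F r in at_top. characteristic r f \<ge> c * r"
  shows "hyper_order f \<ge> 0"
  unfolding hyper_order_def
proof (rule le_Limsup)
  show "\<forall>\<^sub>F r in at_top. 0 \<le> ereal (ln (ln (characteristic r f)) / ln r)"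
    using c(2) eventually_ge_at_top[of 1] eventually_ge_at_top[of "exp 1 / c"]
  proof eventually_elim
    case (elim r)
    then have "exp 1 \<le> characteristic r f" using c(1) by (simp add: field_simps)
    then have "ln (characteristic r f) \<ge> 1"
      using exp_gt_zero[of "1::real"] by (subst ln_ge_iff) linarith+
    then show ?case using elim by simp
  qed
qed simp

section \<open>The truncated second main theorem\<close>

theorem corollary7p2:
  fixes f :: "real \<Rightarrow> real" and \<sigma> \<epsilon> :: real and q :: nat and a :: "nat \<Rightarrow> real"
  assumes "tropical_meromorphic f"
    and "\<not> f constant_on UNIV"
    and "hyper_order f = ereal \<sigma>" and "\<sigma> < 1"
    and "\<epsilon> > 0"
    and "q \<ge> 1"
    and "inj_on a {1..q}"
    and "ereal (Max (a ` {1..q})) < (INF \<alpha>\<in>trop_poles f. ereal (f \<alpha>))"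
  shows "\<exists>E\<subseteq>{0..}. finite_log_measure E \<and>
    (\<lambda>r. real q * characteristic r f
          - (\<Sum>k=1..q. int_pole_count r (\<lambda>x. \<one>\<^sub>t \<oslash>\<^sub>t (f x \<oplus>\<^sub>t a k))))
      \<in> o[inf at_top (principal (- E))](\<lambda>r. characteristic r f / r powr (1 - \<sigma> - \<epsilon>))"
proof -
  note f = tropical_meromorphic_imp_piecewise_affine[OF assms(1)]
  obtain c where c: "c > 0" "\<forall>\<^sub>F r in at_top. characteristic r f \<ge> c * r"
    using characteristic_ge_linear[OF f assms(2)] by blast
  \<comment> \<open>Together with \<open>\<epsilon> > 0\<close> this makes the exponent \<open>\<sigma> + \<epsilon>\<close> below positive.\<close>
  have "\<sigma> \<ge> 0" using hyper_order_nonneg[OF c] assms(3) by simp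
  have poles: "a k < f s" if "k \<in> {1..q}" "s \<in> trop_poles f" for k s
  proof -
    have "ereal (a k) \<le> ereal (Max (a ` {1..q}))" using that by simp
    also have "\<dots> < (INF \<alpha>\<in>trop_poles f. ereal (f \<alpha>))" by fact
    also have "\<dots> \<le> ereal (f s)" using that(2) by (rule INF_lower)
    finally show ?thesis by simp
  qed
  let ?diff = "\<lambda>r. real q * characteristic r f
    - (\<Sum>k=1..q. int_pole_count r (\<lambda>x. \<one>\<^sub>t \<oslash>\<^sub>t (f x \<oplus>\<^sub>t a k)))"
  have "\<bar>?diff r\<bar> \<le> (\<Sum>k=1..q. \<bar>a k\<bar> + \<bar>max (f 0) (a k)\<bar>)" if "r \<ge> 0" for r
  proof -
    have "?diff r =
        (\<Sum>k=1..q. characteristic r f - int_pole_count r (\<lambda>x. - max (f x) (a k)))"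
      by (simp add: sum_subtractf trop_one_def trop_div_def trop_add_def)
    also have "\<bar>\<dots>\<bar> \<le> (\<Sum>k=1..q. \<bar>a k\<bar> + \<bar>max (f 0) (a k)\<bar>)"
      using poles that
      by (intro order.trans[OF sum_abs] sum_mono int_pole_count_truncation_bound[OF f]) auto
    finally show ?thesis .
  qed
  then have "?diff \<in> O[at_top](\<lambda>_. 1)"
    by (intro bigoI[of _ "\<Sum>k=1..q. \<bar>a k\<bar> + \<bar>max (f 0) (a k)\<bar>"])
      (auto intro!: eventually_mono[OF eventually_ge_at_top[of 0]])
  also have "(\<lambda>_. 1) \<in> o[at_top](\<lambda>r::real. r powr (\<sigma> + \<epsilon>))"
  proof (rule smalloI_tendsto)
    have "((\<lambda>r::real. r powr (- (\<sigma> + \<epsilon>))) \<longlongrightarrow> 0) at_top"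
      using \<open>\<sigma> \<ge> 0\<close> \<open>\<epsilon> > 0\<close> by (intro tendsto_neg_powr filterlim_ident) simp
    then show "((\<lambda>r. 1 / r powr (\<sigma> + \<epsilon>)) \<longlongrightarrow> 0) at_top"
      by (simp only: powr_minus_divide)
    show "\<forall>\<^sub>F r::real in at_top. r powr (\<sigma> + \<epsilon>) \<noteq> 0"
      using eventually_gt_at_top[of 0] by eventually_elim simp
  qed
  also have "(\<lambda>r. r powr (\<sigma> + \<epsilon>)) \<in>
      O[at_top](\<lambda>r. characteristic r f / r powr (1 - \<sigma> - \<epsilon>))"
  proof (rule bigoI[of _ "1 / c"])
    show "\<forall>\<^sub>F r in at_top. norm (r powr (\<sigma> + \<epsilon>)) \<le>
        1 / c * norm (characteristic r f / r powr (1 - \<sigma> - \<epsilon>))"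
      using c(2) eventually_gt_at_top[of 0]
    proof eventually_elim
      case (elim r)
      have "r powr (\<sigma> + \<epsilon>) * r powr (1 - \<sigma> - \<epsilon>) = r"
        using elim by (simp flip: powr_add)
      then have "c * r powr (\<sigma> + \<epsilon>) * r powr (1 - \<sigma> - \<epsilon>) \<le> characteristic r f"
        using elim by (simp add: mult.assoc)
      then have "c * r powr (\<sigma> + \<epsilon>) \<le> characteristic r f / r powr (1 - \<sigma> - \<epsilon>)"
        using elim by (simp add: pos_le_divide_eq)
      also have "\<dots> \<le> norm (characteristic r f / r powr (1 - \<sigma> - \<epsilon>))"
        unfolding real_norm_def by (rule abs_ge_self)
      finally have le: "c * r powr (\<sigma> + \<epsilon>) \<le> \<dots>" .
      have "norm (r powr (\<sigma> + \<epsilon>)) = 1 / c * (c * r powr (\<sigma> + \<epsilon>))"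
        using c(1) by simp
      also have "\<dots> \<le> 1 / c * norm (characteristic r f / r powr (1 - \<sigma> - \<epsilon>))"
        using c(1) by (intro mult_left_mono[OF le]) simp
      finally show ?case .
    qed
  qed
  finally have "?diff \<in> o[at_top](\<lambda>r. characteristic r f / r powr (1 - \<sigma> - \<epsilon>))" .
  then show ?thesis
    by (intro exI[of _ "{}"]) (simp add: finite_log_measure_def)
qed

end
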